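(* If $\mathfrak{p}$ is a minimal prime ideal of a reduced mp-ring $A$, then $\mathfrak{p}=\sum_{f\in\mathfrak{p}}J_{f}$, where $J_{f}:=\bigcap_{\mathfrak{m}\in\operatorname{Max}(A)\cap V(f)}\operatorname{Ker}\pi_{\mathfrak{m}}$.
   Context: All rings are commutative (with unit). A ring is a mp-ring if each of its prime ideals contains a unique minimal prime ideal. $\operatorname{Max}(A)$ is the set of maximal ideals, $V(f)=\{\mathfrak{p}\in\operatorname{Spec}(A): f\in\mathfrak{p}\}$, and for a prime ideal $\mathfrak{p}$, $\pi_{\mathfrak{p}}:A\to A_{\mathfrak{p}}$ is the canonical ring map. The empty intersection of ideals is $A$. *)

theory Defs
  imports "HOL-Algebra.QuotRing"
begin

definition reduced_ring :: "('a, 'm) ring_scheme \<Rightarrow> bool" where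
  "reduced_ring R \<longleftrightarrow>
     (\<forall>a \<in> carrier R. \<forall>n::nat. a [^]\<^bsub>R\<^esub> n = \<zero>\<^bsub>R\<^esub> \<longrightarrow> a = \<zero>\<^bsub>R\<^esub>)"

definition minimal_prime :: "'a set \<Rightarrow> ('a, 'm) ring_scheme \<Rightarrow> bool" where
  "minimal_prime P R \<longleftrightarrow>
     primeideal P R \<and> (\<forall>Q. primeideal Q R \<and> Q \<subseteq> P \<longrightarrow> Q = P)"

definition mp_ring :: "('a, 'm) ring_scheme \<Rightarrow> bool" where
  "mp_ring R \<longleftrightarrow>
     cring R \<and> (\<forall>P. primeideal P R \<longrightarrow> (\<exists>!Q. minimal_prime Q R \<and> Q \<subseteq> P))"

definition Spec :: "('a, 'm) ring_scheme \<Rightarrow> 'a set set" where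
  "Spec R = {P. primeideal P R}"

definition Max_Spec :: "('a, 'm) ring_scheme \<Rightarrow> 'a set set" where
  "Max_Spec R = {M. maximalideal M R}"

definition vanishing :: "('a, 'm) ring_scheme \<Rightarrow> 'a \<Rightarrow> 'a set set" where
  "vanishing R f = {P \<in> Spec R. f \<in> P}"

text \<open>The fractions \<open>a/s\<close> and \<open>b/t\<close> with denominators outside \<open>P\<close> are identified
  iff \<open>u a t = u b s\<close> for some \<open>u\<close> outside \<open>P\<close>.\<close>

definition frac_rel ::
    "('a, 'm) ring_scheme \<Rightarrow> 'a set \<Rightarrow> (('a \<times> 'a) \<times> ('a \<times> 'a)) set" where
  "frac_rel R P =
     {((a, s), (b, t)). a \<in> carrier R \<and> b \<in> carrier R \<and>
        s \<in> carrier R - P \<and> t \<in> carrier R - P \<and>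
        (\<exists>u \<in> carrier R - P. u \<otimes>\<^bsub>R\<^esub> (a \<otimes>\<^bsub>R\<^esub> t) = u \<otimes>\<^bsub>R\<^esub> (b \<otimes>\<^bsub>R\<^esub> s))}"

definition loc_frac :: "('a, 'm) ring_scheme \<Rightarrow> 'a set \<Rightarrow> 'a \<Rightarrow> 'a \<Rightarrow> ('a \<times> 'a) set" where
  "loc_frac R P a s = frac_rel R P `` {(a, s)}"

text \<open>The operations take the union of the results over all representatives; for prime \<open>P\<close>
  these results all coincide, see \<open>loc_frac_mult\<close> and \<open>loc_frac_add\<close> below.\<close>

definition localization_at ::
    "('a, 'm) ring_scheme \<Rightarrow> 'a set \<Rightarrow> ('a \<times> 'a) set ring" where
  "localization_at R P =
     \<lparr>carrier = (carrier R \<times> (carrier R - P)) // frac_rel R P,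
      mult = (\<lambda>U V. \<Union>x \<in> U. \<Union>y \<in> V.
                loc_frac R P (fst x \<otimes>\<^bsub>R\<^esub> fst y) (snd x \<otimes>\<^bsub>R\<^esub> snd y)),
      one = loc_frac R P \<one>\<^bsub>R\<^esub> \<one>\<^bsub>R\<^esub>,
      zero = loc_frac R P \<zero>\<^bsub>R\<^esub> \<one>\<^bsub>R\<^esub>,
      add = (\<lambda>U V. \<Union>x \<in> U. \<Union>y \<in> V.
               loc_frac R P (fst x \<otimes>\<^bsub>R\<^esub> snd y \<oplus>\<^bsub>R\<^esub> fst y \<otimes>\<^bsub>R\<^esub> snd x) (snd x \<otimes>\<^bsub>R\<^esub> snd y))\<rparr>"

definition loc_map :: "('a, 'm) ring_scheme \<Rightarrow> 'a set \<Rightarrow> 'a \<Rightarrow> ('a \<times> 'a) set" where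
  "loc_map R P a = loc_frac R P a \<one>\<^bsub>R\<^esub>"

text \<open>Intersecting with the carrier makes the empty intersection the whole ring.\<close>

definition J_ideal :: "('a, 'm) ring_scheme \<Rightarrow> 'a \<Rightarrow> 'a set" where
  "J_ideal R f =
     carrier R \<inter>
     (\<Inter>M \<in> Max_Spec R \<inter> vanishing R f. a_kernel R (localization_at R M) (loc_map R M))"

definition ideal_sum :: "('a, 'm) ring_scheme \<Rightarrow> 'i set \<Rightarrow> ('i \<Rightarrow> 'a set) \<Rightarrow> 'a set" where
  "ideal_sum R A I =
     {finsum R x F | x F. finite F \<and> F \<subseteq> A \<and> (\<forall>i \<in> F. x i \<in> I i)}"

lemma UN_UN_const:
  assumes "x0 \<in> U" "y0 \<in> V" "\<And>x y. x \<in> U \<Longrightarrow> y \<in> V \<Longrightarrow> F x y = C"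
  shows "(\<Union>x \<in> U. \<Union>y \<in> V. F x y) = C"
proof -
  have "(\<Union>x \<in> U. \<Union>y \<in> V. F x y) = (\<Union>x \<in> U. \<Union>y \<in> V. C)"
    using assms(3) by (intro SUP_cong refl) auto
  then show ?thesis using assms(1,2) by auto
qed

context primeideal
begin

lemma compl_one: "\<one> \<in> carrier R - I"
  using I_notcarr one_imp_carrier by auto

lemma compl_mult: "s \<in> carrier R - I \<Longrightarrow> t \<in> carrier R - I \<Longrightarrow> s \<otimes> t \<in> carrier R - I"
  using I_prime by auto

lemma frac_relI:
  assumes "a \<in> carrier R" "b \<in> carrier R" "s \<in> carrier R - I" "t \<in> carrier R - I"
    "u \<in> carrier R - I" "u \<otimes> (a \<otimes> t) = u \<otimes> (b \<otimes> s)"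
  shows "((a, s), (b, t)) \<in> frac_rel R I"
  using assms unfolding frac_rel_def by blast

lemma equiv_frac_rel: "equiv (carrier R \<times> (carrier R - I)) (frac_rel R I)"
proof (rule equivI)
  show "frac_rel R I \<subseteq> (carrier R \<times> (carrier R - I)) \<times> (carrier R \<times> (carrier R - I))"
    by (auto simp: frac_rel_def)
  show "refl_on (carrier R \<times> (carrier R - I)) (frac_rel R I)"
    using frac_relI[OF _ _ _ _ compl_one] by (auto simp: refl_on_def)
  show "sym (frac_rel R I)"
    unfolding sym_def frac_rel_def by (auto; metis DiffI)
  show "trans (frac_rel R I)"
  proof (rule transI, clarify)
    fix a s b t c w
    assume "((a, s), (b, t)) \<in> frac_rel R I" "((b, t), (c, w)) \<in> frac_rel R I"
    then obtain u v where mem: "a \<in> carrier R" "b \<in> carrier R" "c \<in> carrier R"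
      "s \<in> carrier R - I" "t \<in> carrier R - I" "w \<in> carrier R - I"
      "u \<in> carrier R - I" "v \<in> carrier R - I"
      and u: "u \<otimes> (a \<otimes> t) = u \<otimes> (b \<otimes> s)" and v: "v \<otimes> (b \<otimes> w) = v \<otimes> (c \<otimes> t)"
      unfolding frac_rel_def by blast
    have car: "s \<in> carrier R" "t \<in> carrier R" "w \<in> carrier R" "u \<in> carrier R" "v \<in> carrier R"
      using mem by auto
    have "(u \<otimes> v \<otimes> t) \<otimes> (a \<otimes> w) = (v \<otimes> w) \<otimes> (u \<otimes> (a \<otimes> t))"
      using mem car by (simp add: m_ac)
    also have "\<dots> = (u \<otimes> s) \<otimes> (v \<otimes> (b \<otimes> w))"
      unfolding u using mem car by (simp add: m_ac)
    also have "\<dots> = (u \<otimes> v \<otimes> t) \<otimes> (c \<otimes> s)"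
      unfolding v using mem car by (simp add: m_ac)
    finally show "((a, s), (c, w)) \<in> frac_rel R I"
      using mem by (intro frac_relI[where u = "u \<otimes> v \<otimes> t"] compl_mult)
  qed
qed

lemma loc_frac_eq_iff:
  assumes "a \<in> carrier R" "b \<in> carrier R" "s \<in> carrier R - I" "t \<in> carrier R - I"
  shows "loc_frac R I a s = loc_frac R I b t \<longleftrightarrow>
    (\<exists>u \<in> carrier R - I. u \<otimes> (a \<otimes> t) = u \<otimes> (b \<otimes> s))"
proof -
  have "loc_frac R I a s = loc_frac R I b t \<longleftrightarrow> ((a, s), (b, t)) \<in> frac_rel R I"
    unfolding loc_frac_def using assms by (intro eq_equiv_class_iff[OF equiv_frac_rel]) auto
  then show ?thesis using assms by (auto simp: frac_rel_def)
qed

lemma loc_frac_eqI: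
  assumes "a \<in> carrier R" "b \<in> carrier R" "s \<in> carrier R - I" "t \<in> carrier R - I"
    "a \<otimes> t = b \<otimes> s"
  shows "loc_frac R I a s = loc_frac R I b t"
  using assms compl_one by (subst loc_frac_eq_iff) auto

lemma loc_frac_self: "a \<in> carrier R \<Longrightarrow> s \<in> carrier R - I \<Longrightarrow> (a, s) \<in> loc_frac R I a s"
  unfolding loc_frac_def by (rule equiv_class_self[OF equiv_frac_rel]) auto

lemma loc_frac_memD:
  assumes "(b, t) \<in> loc_frac R I a s" "a \<in> carrier R" "s \<in> carrier R - I"
  shows "b \<in> carrier R \<and> t \<in> carrier R - I \<and>
    (\<exists>u \<in> carrier R - I. u \<otimes> (a \<otimes> t) = u \<otimes> (b \<otimes> s))"
  using assms by (auto simp: loc_frac_def frac_rel_def)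

lemma carrier_loc:
  "carrier (localization_at R I) = {loc_frac R I a s | a s. a \<in> carrier R \<and> s \<in> carrier R - I}"
  by (auto simp: localization_at_def quotient_def loc_frac_def)

lemma loc_frac_mult:
  assumes "a \<in> carrier R" "b \<in> carrier R" "s \<in> carrier R - I" "t \<in> carrier R - I"
  shows "loc_frac R I a s \<otimes>\<^bsub>localization_at R I\<^esub> loc_frac R I b t = loc_frac R I (a \<otimes> b) (s \<otimes> t)"
proof -
  have *: "loc_frac R I (a' \<otimes> b') (s' \<otimes> t') = loc_frac R I (a \<otimes> b) (s \<otimes> t)"
    if m1: "(a', s') \<in> loc_frac R I a s" and m2: "(b', t') \<in> loc_frac R I b t" for a' s' b' t'
  proof -
    obtain u v where mem: "a' \<in> carrier R" "b' \<in> carrier R"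
      "s' \<in> carrier R - I" "t' \<in> carrier R - I" "u \<in> carrier R - I" "v \<in> carrier R - I"
      and u: "u \<otimes> (a \<otimes> s') = u \<otimes> (a' \<otimes> s)" and v: "v \<otimes> (b \<otimes> t') = v \<otimes> (b' \<otimes> t)"
      using loc_frac_memD[OF m1] loc_frac_memD[OF m2] assms by blast
    have car: "s \<in> carrier R" "t \<in> carrier R" "s' \<in> carrier R" "t' \<in> carrier R"
      "u \<in> carrier R" "v \<in> carrier R"
      using mem assms by auto
    have "(u \<otimes> v) \<otimes> ((a' \<otimes> b') \<otimes> (s \<otimes> t)) = (u \<otimes> (a' \<otimes> s)) \<otimes> (v \<otimes> (b' \<otimes> t))"
      using mem(1,2) assms(1,2) car by (simp add: m_ac)
    also have "\<dots> = (u \<otimes> v) \<otimes> ((a \<otimes> b) \<otimes> (s' \<otimes> t'))"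
      unfolding u[symmetric] v[symmetric] using mem(1,2) assms(1,2) car by (simp add: m_ac)
    finally show ?thesis
      using mem assms compl_mult by (subst loc_frac_eq_iff) (auto simp del: Diff_iff)
  qed
  have "loc_frac R I a s \<otimes>\<^bsub>localization_at R I\<^esub> loc_frac R I b t =
      (\<Union>x \<in> loc_frac R I a s. \<Union>y \<in> loc_frac R I b t. loc_frac R I (fst x \<otimes> fst y) (snd x \<otimes> snd y))"
    by (simp add: localization_at_def)
  also have "\<dots> = loc_frac R I (a \<otimes> b) (s \<otimes> t)"
    using loc_frac_self[OF assms(1,3)] loc_frac_self[OF assms(2,4)]
    by (rule UN_UN_const) (metis * prod.collapse)
  finally show ?thesis .
qed

lemma loc_frac_add:
  assumes "a \<in> carrier R" "b \<in> carrier R" "s \<in> carrier R - I" "t \<in> carrier R - I"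
  shows "loc_frac R I a s \<oplus>\<^bsub>localization_at R I\<^esub> loc_frac R I b t =
    loc_frac R I (a \<otimes> t \<oplus> b \<otimes> s) (s \<otimes> t)"
proof -
  have *: "loc_frac R I (a' \<otimes> t' \<oplus> b' \<otimes> s') (s' \<otimes> t') = loc_frac R I (a \<otimes> t \<oplus> b \<otimes> s) (s \<otimes> t)"
    if m1: "(a', s') \<in> loc_frac R I a s" and m2: "(b', t') \<in> loc_frac R I b t" for a' s' b' t'
  proof -
    obtain u v where mem: "a' \<in> carrier R" "b' \<in> carrier R"
      "s' \<in> carrier R - I" "t' \<in> carrier R - I" "u \<in> carrier R - I" "v \<in> carrier R - I"
      and u: "u \<otimes> (a \<otimes> s') = u \<otimes> (a' \<otimes> s)" and v: "v \<otimes> (b \<otimes> t') = v \<otimes> (b' \<otimes> t)"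
      using loc_frac_memD[OF m1] loc_frac_memD[OF m2] assms by blast
    have car: "s \<in> carrier R" "t \<in> carrier R" "s' \<in> carrier R" "t' \<in> carrier R"
      "u \<in> carrier R" "v \<in> carrier R"
      using mem assms by auto
    have "(u \<otimes> v) \<otimes> ((a' \<otimes> t' \<oplus> b' \<otimes> s') \<otimes> (s \<otimes> t)) =
        (v \<otimes> t \<otimes> t') \<otimes> (u \<otimes> (a' \<otimes> s)) \<oplus> (u \<otimes> s \<otimes> s') \<otimes> (v \<otimes> (b' \<otimes> t))"
      using mem(1,2) assms(1,2) car by (simp add: m_ac l_distr r_distr)
    also have "\<dots> = (u \<otimes> v) \<otimes> ((a \<otimes> t \<oplus> b \<otimes> s) \<otimes> (s' \<otimes> t'))"
      unfolding u[symmetric] v[symmetric]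
      using mem(1,2) assms(1,2) car by (simp add: m_ac l_distr r_distr)
    finally show ?thesis
      using mem assms compl_mult car
      by (subst loc_frac_eq_iff) (auto simp del: Diff_iff)
  qed
  have "loc_frac R I a s \<oplus>\<^bsub>localization_at R I\<^esub> loc_frac R I b t =
      (\<Union>x \<in> loc_frac R I a s. \<Union>y \<in> loc_frac R I b t.
        loc_frac R I (fst x \<otimes> snd y \<oplus> fst y \<otimes> snd x) (snd x \<otimes> snd y))"
    by (simp add: localization_at_def)
  also have "\<dots> = loc_frac R I (a \<otimes> t \<oplus> b \<otimes> s) (s \<otimes> t)"
    using loc_frac_self[OF assms(1,3)] loc_frac_self[OF assms(2,4)]
    by (rule UN_UN_const) (metis * prod.collapse)
  finally show ?thesis .
qed

lemma zero_loc: "\<zero>\<^bsub>localization_at R I\<^esub> = loc_frac R I \<zero> \<one>"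
  and one_loc: "\<one>\<^bsub>localization_at R I\<^esub> = loc_frac R I \<one> \<one>"
  by (simp_all add: localization_at_def)

lemma loc_frac_closed:
  "a \<in> carrier R \<Longrightarrow> s \<in> carrier R - I \<Longrightarrow> loc_frac R I a s \<in> carrier (localization_at R I)"
  by (auto simp: carrier_loc)

lemma loc_cases:
  assumes "x \<in> carrier (localization_at R I)"
  obtains a s where "x = loc_frac R I a s" "a \<in> carrier R" "s \<in> carrier R - I" "s \<in> carrier R"
  using assms by (auto simp: carrier_loc)

lemma cring_localization: "cring (localization_at R I)"
proof -
  have one: "\<one> \<in> carrier R - I" by (rule compl_one)
  show ?thesis
  proof (intro cringI abelian_groupI comm_monoidI)
    let ?L = "localization_at R I"
    fix x y assume x: "x \<in> carrier ?L" and y: "y \<in> carrier ?L"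
    obtain a s where a: "x = loc_frac R I a s" "a \<in> carrier R" "s \<in> carrier R - I" "s \<in> carrier R"
      using x by (rule loc_cases)
    obtain b t where b: "y = loc_frac R I b t" "b \<in> carrier R" "t \<in> carrier R - I" "t \<in> carrier R"
      using y by (rule loc_cases)
    note m = compl_mult[OF a(3) b(3)] compl_mult[OF b(3) a(3)]
    show "x \<oplus>\<^bsub>?L\<^esub> y \<in> carrier ?L" "x \<otimes>\<^bsub>?L\<^esub> y \<in> carrier ?L"
      using a b m by (simp_all add: loc_frac_add loc_frac_mult loc_frac_closed del: Diff_iff)
    show "x \<oplus>\<^bsub>?L\<^esub> y = y \<oplus>\<^bsub>?L\<^esub> x" "x \<otimes>\<^bsub>?L\<^esub> y = y \<otimes>\<^bsub>?L\<^esub> x"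
      using a b by (simp_all add: loc_frac_add loc_frac_mult m_comm a_comm del: Diff_iff)
    fix z assume z: "z \<in> carrier ?L"
    obtain c w where c: "z = loc_frac R I c w" "c \<in> carrier R" "w \<in> carrier R - I" "w \<in> carrier R"
      using z by (rule loc_cases)
    note m' = m compl_mult[OF a(3) c(3)] compl_mult[OF b(3) c(3)]
      compl_mult[OF m(1) c(3)] compl_mult[OF a(3) compl_mult[OF b(3) c(3)]]
      compl_mult[OF compl_mult[OF a(3) c(3)] compl_mult[OF b(3) c(3)]]
    show "x \<oplus>\<^bsub>?L\<^esub> y \<oplus>\<^bsub>?L\<^esub> z = x \<oplus>\<^bsub>?L\<^esub> (y \<oplus>\<^bsub>?L\<^esub> z)"
      using a(2-) b(2-) c(2-) m' unfolding a(1) b(1) c(1)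
      by (simp add: loc_frac_add m_ac a_ac l_distr r_distr del: Diff_iff)
    show "x \<otimes>\<^bsub>?L\<^esub> y \<otimes>\<^bsub>?L\<^esub> z = x \<otimes>\<^bsub>?L\<^esub> (y \<otimes>\<^bsub>?L\<^esub> z)"
      using a(2-) b(2-) c(2-) m' unfolding a(1) b(1) c(1)
      by (simp add: loc_frac_mult m_assoc del: Diff_iff)
    have "loc_frac R I ((a \<otimes> t \<oplus> b \<otimes> s) \<otimes> c) (s \<otimes> t \<otimes> w) =
        loc_frac R I ((a \<otimes> c) \<otimes> (t \<otimes> w) \<oplus> (b \<otimes> c) \<otimes> (s \<otimes> w)) ((s \<otimes> w) \<otimes> (t \<otimes> w))"
      using a(2-) b(2-) c(2-) m'
      by (intro loc_frac_eqI) (simp_all add: m_ac l_distr r_distr del: Diff_iff)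
    then show "(x \<oplus>\<^bsub>?L\<^esub> y) \<otimes>\<^bsub>?L\<^esub> z = x \<otimes>\<^bsub>?L\<^esub> z \<oplus>\<^bsub>?L\<^esub> y \<otimes>\<^bsub>?L\<^esub> z"
      using a(2-) b(2-) c(2-) m' unfolding a(1) b(1) c(1)
      by (simp add: loc_frac_add loc_frac_mult del: Diff_iff)
  next
    let ?L = "localization_at R I"
    show "\<zero>\<^bsub>?L\<^esub> \<in> carrier ?L" "\<one>\<^bsub>?L\<^esub> \<in> carrier ?L"
      using one by (simp_all add: zero_loc one_loc loc_frac_closed del: Diff_iff)
    fix x assume x: "x \<in> carrier ?L"
    obtain a s where a: "x = loc_frac R I a s" "a \<in> carrier R" "s \<in> carrier R - I" "s \<in> carrier R"
      using x by (rule loc_cases)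
    show "\<zero>\<^bsub>?L\<^esub> \<oplus>\<^bsub>?L\<^esub> x = x" "\<one>\<^bsub>?L\<^esub> \<otimes>\<^bsub>?L\<^esub> x = x"
      using a one by (simp_all add: zero_loc one_loc loc_frac_add loc_frac_mult del: Diff_iff)
    have "loc_frac R I (\<ominus> a \<otimes> s \<oplus> a \<otimes> s) (s \<otimes> s) = loc_frac R I \<zero> \<one>"
      using a one compl_mult[OF a(3) a(3)]
      by (intro loc_frac_eqI) (simp_all add: l_minus l_neg del: Diff_iff)
    then have "loc_frac R I (\<ominus> a) s \<oplus>\<^bsub>?L\<^esub> x = \<zero>\<^bsub>?L\<^esub>"
      using a by (simp add: zero_loc loc_frac_add del: Diff_iff)
    then show "\<exists>y \<in> carrier ?L. y \<oplus>\<^bsub>?L\<^esub> x = \<zero>\<^bsub>?L\<^esub>"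
      using a by (intro bexI[where x = "loc_frac R I (\<ominus> a) s"]) (simp_all add: loc_frac_closed del: Diff_iff)
  qed
qed

lemma loc_map_hom: "loc_map R I \<in> ring_hom R (localization_at R I)"
  using compl_one
  by (intro ring_hom_memI)
     (simp_all add: loc_map_def loc_frac_closed loc_frac_mult loc_frac_add one_loc del: Diff_iff)

lemma kernel_loc_map:
  "a_kernel R (localization_at R I) (loc_map R I) =
     {a \<in> carrier R. \<exists>u \<in> carrier R - I. u \<otimes> a = \<zero>}"
proof -
  have "loc_frac R I a \<one> = loc_frac R I \<zero> \<one> \<longleftrightarrow> (\<exists>u \<in> carrier R - I. u \<otimes> a = \<zero>)"
    if "a \<in> carrier R" for a
    using that compl_one by (subst loc_frac_eq_iff) (auto simp del: Diff_iff intro!: bex_cong)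
  then show ?thesis by (auto simp: a_kernel_def' loc_map_def zero_loc simp del: Diff_iff)
qed

end

end

theory Submission
  imports Defs "HOL-Algebra.Ring_Divisibility"
begin

text \<open>
  Let \<open>\<pp>\<close> be a minimal prime of the reduced mp-ring \<open>A\<close>.

  For the inclusion from right to left, let \<open>f \<in> \<pp>\<close> and choose a maximal ideal
  \<open>M\<close> above \<open>\<pp>\<close>. It contains \<open>f\<close>, and an element killed by some \<open>u \<notin> M\<close> lies in \<open>\<pp>\<close> because
  \<open>u \<notin> \<pp>\<close>. Hence \<open>J\<^sub>f \<subseteq> Ker \<pi>\<^sub>M \<subseteq> \<pp>\<close>.

  For the other inclusion, each \<open>f \<in> \<pp>\<close> even lies in a single \<open>J\<^sub>b\<close> with \<open>b \<in> \<pp>\<close>. Since \<open>\<pp>\<close> is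
  minimal and \<open>A\<close> is reduced, \<open>f g = 0\<close> for some \<open>g \<notin> \<pp>\<close>. The mp-property makes the annihilators
  of \<open>f\<close> and \<open>g\<close> comaximal, say \<open>a + b = 1\<close> with \<open>a f = 0\<close> and \<open>b g = 0\<close>. From \<open>b g = 0\<close> and
  \<open>g \<notin> \<pp>\<close> it follows that \<open>b \<in> \<pp>\<close>. A maximal ideal that contains \<open>b\<close> cannot contain \<open>a = 1 - b\<close>, and
  \<open>a\<close> kills \<open>f\<close>, so \<open>f \<in> J\<^sub>b\<close>.

  Minimality and the mp-property enter through one fact (\<open>reduced_killed_outside_prime\<close>): in a
  reduced ring, an element that lies in all primes below \<open>P\<close> is killed by something outside \<open>P\<close>.
  It is applied to \<open>P = \<pp>\<close>, which is the only prime below itself, and to a maximal ideal, whose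
  only minimal prime is contained in all the primes below it.
\<close>

lemma (in ring) exists_ideal_maximal_avoiding:
  assumes "ideal I R" "I \<inter> S = {}"
  obtains P where "ideal P R" "I \<subseteq> P" "P \<inter> S = {}"
    "\<forall>J. ideal J R \<and> P \<subseteq> J \<and> J \<inter> S = {} \<longrightarrow> J = P"
proof -
  let ?\<I> = "{J. ideal J R \<and> I \<subseteq> J \<and> J \<inter> S = {}}"
  have "\<exists>P \<in> ?\<I>. \<forall>J \<in> ?\<I>. P \<subseteq> J \<longrightarrow> J = P"
  proof (rule subset_Zorn)
    fix C assume chain: "subset.chain ?\<I> C"
    show "\<exists>U \<in> ?\<I>. \<forall>J \<in> C. J \<subseteq> U"
    proof (cases "C = {}")
      case True
      then show ?thesis using assms by auto
    next
      case False
      have "subset.chain {J. ideal J R} C"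
        using chain by (auto simp: subset_chain_def)
      then have "ideal (\<Union>C) R"
        using chain_Union_is_ideal[of C] False by simp
      moreover have "I \<subseteq> \<Union>C" "\<Union>C \<inter> S = {}"
        using chain False unfolding subset_chain_def by blast+
      ultimately show ?thesis by blast
    qed
  qed
  then obtain P where "P \<in> ?\<I>" "\<forall>J \<in> ?\<I>. P \<subseteq> J \<longrightarrow> J = P" by blast
  then show thesis by (intro that[of P]) auto
qed

lemma (in cring) exists_prime_avoiding:
  assumes one: "\<one> \<in> S" and zero: "\<zero> \<notin> S"
    and mult: "\<And>s t. s \<in> S \<Longrightarrow> t \<in> S \<Longrightarrow> s \<otimes> t \<in> S"
  obtains P where "primeideal P R" "P \<inter> S = {}"
proof -
  obtain P where P: "ideal P R" "P \<inter> S = {}"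
    and max: "\<forall>J. ideal J R \<and> P \<subseteq> J \<and> J \<inter> S = {} \<longrightarrow> J = P"
  proof -
    have "{\<zero>} \<inter> S = {}" using zero by simp
    then show thesis using exists_ideal_maximal_avoiding[OF zeroideal] that by metis
  qed
  interpret P: ideal P R by fact
  \<comment> \<open>By maximality the ideal \<open>P + (a)\<close> meets \<open>S\<close> for every \<open>a\<close> outside \<open>P\<close>.\<close>
  have meets: "\<exists>p \<in> P. \<exists>r \<in> carrier R. p \<oplus> r \<otimes> a \<in> S" if a: "a \<in> carrier R" "a \<notin> P" for a
  proof -
    let ?J = "P <+>\<^bsub>R\<^esub> PIdl a"
    have J: "ideal ?J R"
      using add_ideals[OF P(1) cgenideal_ideal[OF a(1)]] .
    have "P \<union> PIdl a \<subseteq> ?J"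
      using union_genideal[OF P(1) cgenideal_ideal[OF a(1)]] genideal_self[of "P \<union> PIdl a"]
        P.a_subset ideal.Icarr[OF cgenideal_ideal[OF a(1)]] by auto
    moreover have "a \<in> PIdl a" using cgenideal_self[OF a(1)] .
    ultimately have "?J \<noteq> P" "P \<subseteq> ?J" using a by auto
    then obtain s where "s \<in> ?J" "s \<in> S" using max J by blast
    then show ?thesis by (auto simp: set_add_def' cgenideal_def)
  qed
  have "primeideal P R"
  proof (rule primeidealI[OF P(1) is_cring])
    show "carrier R \<noteq> P" using one P(2) one_closed by blast
    fix a b assume ab: "a \<in> carrier R" "b \<in> carrier R" "a \<otimes> b \<in> P"
    show "a \<in> P \<or> b \<in> P"
    proof (rule ccontr)
      assume "\<not> ?thesis"
      then obtain p r q t where *: "p \<in> P" "r \<in> carrier R" "p \<oplus> r \<otimes> a \<in> S"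
        "q \<in> P" "t \<in> carrier R" "q \<oplus> t \<otimes> b \<in> S"
        using meets ab by metis
      have car: "p \<in> carrier R" "q \<in> carrier R" using * P.Icarr by auto
      have "(p \<oplus> r \<otimes> a) \<otimes> (q \<oplus> t \<otimes> b)
          = p \<otimes> (q \<oplus> t \<otimes> b) \<oplus> ((r \<otimes> a) \<otimes> q \<oplus> (r \<otimes> t) \<otimes> (a \<otimes> b))"
        using * ab car by (simp add: l_distr r_distr m_ac a_ac)
      also have "\<dots> \<in> P"
        using * ab car by (auto intro!: P.a_closed simp: P.I_r_closed P.I_l_closed)
      finally show False using mult[OF *(3,6)] P(2) by blast
    qed
  qed
  then show thesis using that P(2) by blast
qed

lemma (in ring) exists_maximal_above:
  assumes "ideal I R" "\<one> \<notin> I"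
  obtains M where "maximalideal M R" "I \<subseteq> M"
proof -
  obtain M where M: "ideal M R" "I \<subseteq> M" "M \<inter> {\<one>} = {}"
    and max: "\<forall>J. ideal J R \<and> M \<subseteq> J \<and> J \<inter> {\<one>} = {} \<longrightarrow> J = M"
    using exists_ideal_maximal_avoiding[OF assms(1), of "{\<one>}"] assms(2) by blast
  have "maximalideal M R"
  proof (rule maximalidealI[OF M(1)])
    show "carrier R \<noteq> M" using M(3) by auto
    show "J = M \<or> J = carrier R" if "ideal J R" "M \<subseteq> J" for J
      using max that ideal.one_imp_carrier[OF that(1)] by blast
  qed
  then show thesis using that M(2) by blast
qed

text \<open>The localization of a reduced ring at \<open>P\<close> is again reduced, so an element that lies in all of
  its primes vanishes there. Seen from \<open>R\<close> itself: if nothing outside \<open>P\<close> killed \<open>f\<close>, the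
  products \<open>u f\<^sup>n\<close> with \<open>u \<notin> P\<close> would form a multiplicative set
  without zero, and a prime avoiding it would lie below \<open>P\<close> without containing \<open>f\<close>.\<close>

lemma (in cring) reduced_killed_outside_prime:
  assumes red: "reduced_ring R" and P: "primeideal P R" and f: "f \<in> carrier R"
    and below: "\<And>Q. primeideal Q R \<Longrightarrow> Q \<subseteq> P \<Longrightarrow> f \<in> Q"
  shows "\<exists>u \<in> carrier R - P. u \<otimes> f = \<zero>"
proof (rule ccontr)
  assume nk: "\<not> ?thesis"
  interpret P: primeideal P R by fact
  define S where "S = {u \<otimes> f [^] n | u n. u \<in> carrier R - P \<and> n \<in> (UNIV :: nat set)}"
  have SI: "u \<otimes> f [^] n \<in> S" if "u \<in> carrier R - P" for u and n :: nat
    using that by (auto simp: S_def)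
  have "\<zero> \<notin> S"
  proof
    assume "\<zero> \<in> S"
    then obtain u and n :: nat where u: "u \<in> carrier R - P" "u \<otimes> f [^] n = \<zero>"
      by (force simp: S_def)
    \<comment> \<open>The extra factor \<open>u f\<close> covers \<open>n = 0\<close>.\<close>
    have "(u \<otimes> f) [^] Suc n = u [^] n \<otimes> f \<otimes> (u \<otimes> f [^] n)"
      using u(1) f by (simp add: nat_pow_distrib m_ac)
    also have "\<dots> = \<zero>" using u f by simp
    finally have "u \<otimes> f = \<zero>" using red u(1) f unfolding reduced_ring_def by blast
    then show False using nk u(1) by blast
  qed
  moreover have "\<one> \<in> S" using SI[OF P.compl_one, of 0] by simp
  moreover have "s \<otimes> t \<in> S" if st: "s \<in> S" "t \<in> S" for s t
  proof -
    obtain u v and m n :: nat where uv: "u \<in> carrier R - P" "v \<in> carrier R - P"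
      "s = u \<otimes> f [^] m" "t = v \<otimes> f [^] n"
      using st unfolding S_def by blast
    have "s \<otimes> t = (u \<otimes> v) \<otimes> f [^] (m + n)"
    proof -
      have "u \<in> carrier R" "v \<in> carrier R" "f [^] m \<in> carrier R" "f [^] n \<in> carrier R"
        using uv(1,2) f by auto
      then show ?thesis
        unfolding uv(3,4) nat_pow_mult[OF f, symmetric] by (simp add: m_ac)
    qed
    then show ?thesis using SI[OF P.compl_mult[OF uv(1,2)], of "m + n"] by metis
  qed
  ultimately obtain Q where Q: "primeideal Q R" "Q \<inter> S = {}"
    using exists_prime_avoiding by blast
  have "carrier R - P \<subseteq> S"
  proof
    show "u \<in> S" if "u \<in> carrier R - P" for u using SI[OF that, of 0] that by simp
  qed
  moreover have "Q \<subseteq> carrier R"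
    using ideal.Icarr[OF primeideal.axioms(1)[OF Q(1)]] by (rule subsetI)
  ultimately have "Q \<subseteq> P" using Q(2) by auto
  moreover have "f \<in> S" using SI[OF P.compl_one, of 1] f by simp
  ultimately show False using below[OF Q(1)] Q(2) by blast
qed

lemma (in cring) annihilator_ideal:
  assumes f: "f \<in> carrier R"
  shows "ideal {a \<in> carrier R. a \<otimes> f = \<zero>} R"
proof (rule idealI[OF ring_axioms])
  show "subgroup {a \<in> carrier R. a \<otimes> f = \<zero>} (add_monoid R)"
    by (rule group.subgroupI[OF a_group]) (use f in \<open>auto simp: l_distr l_minus simp flip: a_inv_def\<close>)
  fix a x assume a: "a \<in> {a \<in> carrier R. a \<otimes> f = \<zero>}" and x: "x \<in> carrier R"
  then show "x \<otimes> a \<in> {a \<in> carrier R. a \<otimes> f = \<zero>}"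
    using f by (simp add: m_assoc)
  then show "a \<otimes> x \<in> {a \<in> carrier R. a \<otimes> f = \<zero>}"
    using a x by (simp add: m_comm)
qed

text \<open>Otherwise a maximal ideal \<open>M\<close> contains both annihilators. The unique minimal prime \<open>Q\<close>
  below \<open>M\<close> contains \<open>f\<close> or \<open>g\<close>, and with it every prime below \<open>M\<close> does; so this factor is killed
  by an element outside \<open>M\<close>, although its annihilator is inside \<open>M\<close>.\<close>

lemma comaximal_annihilators:
  fixes R (structure)
  assumes mp: "mp_ring R" and red: "reduced_ring R"
    and fg: "f \<in> carrier R" "g \<in> carrier R" "f \<otimes> g = \<zero>"
  obtains a b where "a \<in> carrier R" "b \<in> carrier R" "a \<otimes> f = \<zero>" "b \<otimes> g = \<zero>" "a \<oplus> b = \<one>"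
proof -
  interpret cring R using mp by (simp add: mp_ring_def)
  let ?F = "{a \<in> carrier R. a \<otimes> f = \<zero>}" and ?G = "{a \<in> carrier R. a \<otimes> g = \<zero>}"
  have idl: "ideal ?F R" "ideal ?G R" using annihilator_ideal fg by auto
  have "\<one> \<in> ?F <+>\<^bsub>R\<^esub> ?G"
  proof (rule ccontr)
    assume "\<one> \<notin> ?F <+>\<^bsub>R\<^esub> ?G"
    then obtain M where M: "maximalideal M R" "?F <+>\<^bsub>R\<^esub> ?G \<subseteq> M"
      using exists_maximal_above[OF add_ideals[OF idl]] by blast
    have "?F \<union> ?G \<subseteq> ?F <+>\<^bsub>R\<^esub> ?G"
      unfolding union_genideal[OF idl, symmetric] by (intro genideal_self) auto
    then have ann: "?F \<subseteq> M" "?G \<subseteq> M" using M(2) by auto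
    have prime: "primeideal M R" using maximalideal_prime[OF M(1)] .
    have unique: "\<exists>!Q. minimal_prime Q R \<and> Q \<subseteq> P" if "primeideal P R" for P
      using mp that unfolding mp_ring_def by blast
    obtain Q where Q: "minimal_prime Q R" "Q \<subseteq> M" using unique[OF prime] by blast
    have least: "Q \<subseteq> P" if "primeideal P R" "P \<subseteq> M" for P
      using unique[OF that(1)] unique[OF prime] Q that(2) by (metis order_trans)
    interpret Q: primeideal Q R using Q(1) by (simp add: minimal_prime_def)
    have "f \<in> Q \<or> g \<in> Q" using fg Q.I_prime Q.zero_closed by auto
    then obtain h where h: "h \<in> {f, g}" "h \<in> Q" by blast
    then obtain u where "u \<in> carrier R - M" "u \<otimes> h = \<zero>"
      using reduced_killed_outside_prime[OF red prime, of h] least fg by blast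
    then show False using h(1) ann by blast
  qed
  then show thesis using that by (auto simp: set_add_def')
qed

lemma (in primeideal) kernel_loc_map_subset:
  assumes "I \<subseteq> M" "primeideal M R"
  shows "a_kernel R (localization_at R M) (loc_map R M) \<subseteq> I"
proof
  fix a assume "a \<in> a_kernel R (localization_at R M) (loc_map R M)"
  then obtain u where a: "a \<in> carrier R" and u: "u \<in> carrier R" "u \<notin> M" "u \<otimes> a = \<zero>"
    unfolding primeideal.kernel_loc_map[OF assms(2)] by blast
  have "u \<otimes> a \<in> I" using u(3) zero_closed by simp
  then show "a \<in> I" using I_prime[OF u(1) a] assms(1) u(2) by blast
qed

lemma (in primeideal) J_ideal_subset:
  assumes "f \<in> I"
  shows "J_ideal R f \<subseteq> I"
proof -
  have "\<one> \<notin> I" using compl_one by simp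
  then obtain M where M: "maximalideal M R" "I \<subseteq> M"
    using exists_maximal_above[OF is_ideal] by blast
  have prime: "primeideal M R" using maximalideal_prime[OF M(1)] .
  have "M \<in> Max_Spec R \<inter> vanishing R f"
    using M prime assms by (auto simp: Max_Spec_def vanishing_def Spec_def)
  then show ?thesis
    using kernel_loc_map_subset[OF M(2) prime] unfolding J_ideal_def by blast
qed

lemma (in cring) mem_J_idealI:
  assumes car: "a \<in> carrier R" "f \<in> carrier R" and af: "a \<otimes> f = \<zero>" and ab: "a \<oplus> b = \<one>"
  shows "f \<in> J_ideal R b"
proof -
  have "f \<in> a_kernel R (localization_at R M) (loc_map R M)"
    if "M \<in> Max_Spec R \<inter> vanishing R b" for M
  proof -
    have M: "primeideal M R" "b \<in> M" using that by (auto simp: vanishing_def Spec_def)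
    interpret M: primeideal M R by (fact M(1))
    have "a \<notin> M" using M.a_closed[OF _ M(2)] M.compl_one unfolding ab[symmetric] by blast
    then show ?thesis using car af unfolding M.kernel_loc_map by blast
  qed
  then show ?thesis using car by (auto simp: J_ideal_def)
qed

lemma (in ideal) ideal_sum_subset:
  assumes "\<And>i. i \<in> A \<Longrightarrow> J i \<subseteq> I"
  shows "ideal_sum R A J \<subseteq> I"
proof -
  have "finsum R x F \<in> I" if "finite F" "\<forall>i \<in> F. x i \<in> I" for x F
    using that by (induction F) (auto simp: Pi_def Icarr)
  then show ?thesis using assms unfolding ideal_sum_def by blast
qed

lemma (in ring) mem_ideal_sumI:
  assumes "i \<in> A" "a \<in> J i" "a \<in> carrier R"
  shows "a \<in> ideal_sum R A J"
proof -
  have "finsum R (\<lambda>_. a) {i} = a" using assms(3) by simp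
  then show ?thesis using assms unfolding ideal_sum_def
    by (auto intro!: exI[of _ "\<lambda>_. a"] exI[of _ "{i}"])
qed

theorem corollary7p6:
  fixes A :: "('a, 'm) ring_scheme" and \<pp> :: "'a set"
  assumes "mp_ring A"
    and "reduced_ring A"
    and "minimal_prime \<pp> A"
  shows "\<pp> = ideal_sum A \<pp> (\<lambda>f. J_ideal A f)"
proof
  interpret primeideal \<pp> A using assms(3) by (simp add: minimal_prime_def)
  show "ideal_sum A \<pp> (J_ideal A) \<subseteq> \<pp>"
    using J_ideal_subset by (rule ideal_sum_subset)
  show "\<pp> \<subseteq> ideal_sum A \<pp> (J_ideal A)"
  proof
    fix f assume f: "f \<in> \<pp>"
    have "f \<in> Q" if "primeideal Q A" "Q \<subseteq> \<pp>" for Q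
      using assms(3) that f unfolding minimal_prime_def by blast
    then obtain g where g: "g \<in> carrier A - \<pp>" "g \<otimes>\<^bsub>A\<^esub> f = \<zero>\<^bsub>A\<^esub>"
      using reduced_killed_outside_prime[OF assms(2) primeideal Icarr[OF f]] by blast
    then have fg: "f \<in> carrier A" "g \<in> carrier A" "f \<otimes>\<^bsub>A\<^esub> g = \<zero>\<^bsub>A\<^esub>"
      using Icarr[OF f] by (auto simp: m_comm)
    obtain a b where ab: "a \<in> carrier A" "b \<in> carrier A" "a \<otimes>\<^bsub>A\<^esub> f = \<zero>\<^bsub>A\<^esub>"
      "b \<otimes>\<^bsub>A\<^esub> g = \<zero>\<^bsub>A\<^esub>" "a \<oplus>\<^bsub>A\<^esub> b = \<one>\<^bsub>A\<^esub>"
      using comaximal_annihilators[OF assms(1,2) fg] by blast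
    have "b \<in> \<pp>" using I_prime[OF ab(2) fg(2)] ab(4) zero_closed g(1) by auto
    moreover have "f \<in> J_ideal A b" using mem_J_idealI[OF ab(1) fg(1) ab(3,5)] .
    ultimately show "f \<in> ideal_sum A \<pp> (J_ideal A)" using fg(1) by (rule mem_ideal_sumI)
  qed
qed

end
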